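(* Suppose that $p_{\bm{x}}(\bm{\theta})$ is differentiable in $\bm\theta$ and is a member of the exponential family, $p_{\bm{x}}(\bm{\theta})=\beta(\bm{x})\exp(\bm{\gamma}(\bm{x})^\top\bm{\eta}(\bm{\theta})-A(\bm{\theta}))$, with Jacobian $\nabla\bm{\eta}(\bm{\theta})$ being a $p\times p$ invertible matrix, and that there exists an invertible matrix $\bm{\Omega}\in\mathbb{R}^{p\times p}$ (not depending on $\bm\theta$) such that $\bm{\Omega}\bm{\gamma}(\bm{X})$ is an unbiased estimator of $\bm{\theta}$, i.e., $\mathbb{E}_{p_{\bm{x}}(\bm{\theta})}[\bm{\Omega}\bm{\gamma}(\bm{X})]=\bm{\theta}$. Then $$\bm{I}_{p_{\bm{x}}}(\bm{\theta})=\big(\mathbb{V}_{p_{\bm{x}}(\bm{\theta})}[\bm{\Omega}\bm{\gamma}(\bm{X})]\big)^{-1}=\nabla\bm{\eta}(\bm{\theta})^\top\bm{\Omega}^{-1}.$$ In particular, if $f$ is differentiable, then the update formula providing the stationary point of the minimization of $u(\bm{\theta}|\bm{\theta}^{(t-1)})$ (that is, the point $\bm{\theta}^{(t)}$ with $\nabla_{\bm{\theta}}u(\bm{\theta}|\bm{\theta}^{(t-1)})|_{\bm{\theta}=\bm{\theta}^{(t)}}=\bm{0}$) reduces to the natural gradient descent $$\bm{\theta}^{(t)}=\bm{\theta}^{(t-1)}-\bm{I}_{p_{\bm{x}}}(\bm{\theta}^{(t-1)})^{-1}\nabla f(\bm{\theta}^{(t-1)}).$$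
   Context: Setting. $\Theta\subset\mathbb{R}^p$ is a closed convex set and $f$ is the function to be minimized over $\Theta$. $\bm{X}$ is a random vector with support $\Xi$ whose distribution has a density (or probability mass function, or a hybrid; integrals are then replaced by sums) $p_{\bm{x}}(\bm{\theta})$, $\bm x\in\Xi$, with parameter $\bm{\theta}$, satisfying $\mathrm{int}\,\Theta=\{\bm{\theta}\in\mathbb{R}^p: p_{\bm{x}}(\bm{\theta})>0\}$. $G:\Xi\to(0,\infty)$ is a function satisfying $f(\bm{\theta})=-\ln\mathbb{E}_{p_{\bm{x}}(\bm{\theta})}[G(\bm{X})]$ for all $\bm{\theta}\in\mathrm{int}\,\Theta$. $\mathbb{E}_{p_{\bm{x}}(\bm{\theta})}[\cdot]$ and $\mathbb{V}_{p_{\bm{x}}(\bm{\theta})}[\cdot]$ denote the expectation and the covariance matrix when $\bm{X}$ has distribution $p_{\bm{x}}(\bm{\theta})$. Exponential family: functions $A:\mathbb{R}^p\to\mathbb{R}$, $\beta:\Xi\to[0,\infty)$, $\bm{\eta}:\mathbb{R}^p\to\mathbb{R}^p$, $\bm{\gamma}:\Xi\to\mathbb{R}^p$. $\nabla\bm{\eta}(\bm{\theta}):=(\nabla\eta_1(\bm{\theta}),\ldots,\nabla\eta_p(\bm{\theta}))^\top$ is the Jacobian. Define $q_{\bm{x}}(\bar{\bm{\theta}}):=G(\bm{x})p_{\bm{x}}(\bar{\bm{\theta}})/\mathbb{E}_{p_{\bm{x}}(\bar{\bm{\theta}})}[G(\bm{X})]$ and the surrogate function $$u(\bm{\theta}|\bar{\bm{\theta}}):=-\int_{\bm{x}\in\Xi}q_{\bm{x}}(\bar{\bm{\theta}})\ln\frac{G(\bm{x})p_{\bm{x}}(\bm{\theta})}{q_{\bm{x}}(\bar{\bm{\theta}})}\,d\bm{x},\qquad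 \bm\theta,\bar{\bm\theta}\in\mathrm{int}\,\Theta.$$ The EM algorithm starts from $\bm{\theta}^{(0)}\in\mathrm{int}\,\Theta$ and iterates $\bm{\theta}^{(t)}\in\arg\min_{\bm{\theta}\in\Theta}u(\bm{\theta}|\bm{\theta}^{(t-1)})$. Fisher information matrix: $\bm{I}_{p_{\bm{x}}}(\bm{\theta}):=\mathbb{E}_{p_{\bm{x}}(\bm{\theta})}[\nabla\ln p_{\bm{X}}(\bm{\theta})\,\nabla\ln p_{\bm{X}}(\bm{\theta})^\top]$, gradients being with respect to $\bm{\theta}$. *)

theory Defs
  imports "HOL-Probability.Probability"
begin

text \<open>
  The Jacobian of \<open>\<eta>\<close> is the library's \<^const>\<open>jacobian\<close>, whose \<open>i\<close>-th row is the gradient of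
  the \<open>i\<close>-th component of \<open>\<eta>\<close>.
\<close>

definition gradient :: "('a::real_inner \<Rightarrow> real) \<Rightarrow> 'a \<Rightarrow> 'a" where
  "gradient g \<theta> = (THE D. GDERIV g \<theta> :> D)"

lemma gradient_eqI:
  assumes "GDERIV g \<theta> :> D"
  shows "gradient g \<theta> = D"
  unfolding gradient_def
proof (rule the_equality)
  fix D' assume "GDERIV g \<theta> :> D'"
  then have "(\<lambda>h. h \<bullet> D') = (\<lambda>h. h \<bullet> D)"
    using assms unfolding gderiv_def by (rule has_derivative_unique)
  then have "(D' - D) \<bullet> D' = (D' - D) \<bullet> D"
    by (rule fun_cong)
  then have "(D' - D) \<bullet> (D' - D) = 0"
    by (simp add: inner_diff_right)
  then show "D' = D"
    by simp
qed (rule assms)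

text \<open>\<open>outer_product v w\<close> is the matrix \<open>v w\<^sup>T\<close>.\<close>

definition outer_product :: "real ^ 'm \<Rightarrow> real ^ 'n \<Rightarrow> real ^ 'n ^ 'm" where
  "outer_product v w = (\<chi> i j. v $ i * w $ j)"

definition covariance_matrix :: "'x measure \<Rightarrow> ('x \<Rightarrow> real ^ 'p) \<Rightarrow> real ^ 'p ^ 'p" where
  "covariance_matrix P Y =
     (\<integral>x. outer_product (Y x - (\<integral>y. Y y \<partial>P)) (Y x - (\<integral>y. Y y \<partial>P)) \<partial>P)"

text \<open>
  A parametric model is given by a reference measure \<open>\<mu>\<close>, a support \<open>\<Xi>\<close>, and
  densities \<open>p x \<theta>\<close> with respect to \<open>\<mu>\<close>, restricted to \<open>\<Xi>\<close>.  Lebesgue measure gives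
  probability densities, counting measure gives probability mass functions, and other choices of
  \<open>\<mu>\<close> cover hybrid cases.  The distribution lives on \<open>\<Xi>\<close>, so
  functions such as \<open>G\<close> and \<open>\<gamma>\<close> matter only on \<open>\<Xi>\<close>.
\<close>

definition model_distr ::
  "'x measure \<Rightarrow> 'x set \<Rightarrow> ('x \<Rightarrow> real ^ 'p \<Rightarrow> real) \<Rightarrow> real ^ 'p \<Rightarrow> 'x measure" where
  "model_distr \<mu> \<Xi> p \<theta> = density (restrict_space \<mu> \<Xi>) (\<lambda>x. ennreal (p x \<theta>))"

definition density_family ::
  "'x measure \<Rightarrow> 'x set \<Rightarrow> (real ^ 'p) set \<Rightarrow> ('x \<Rightarrow> real ^ 'p \<Rightarrow> real) \<Rightarrow> bool" where
  "density_family \<mu> \<Xi> \<Theta> p \<longleftrightarrow>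
     \<Xi> \<in> sets \<mu> \<and>
     (\<forall>x\<in>\<Xi>. interior \<Theta> = {\<theta>. p x \<theta> > 0}) \<and>
     (\<forall>\<theta>\<in>interior \<Theta>. (\<lambda>x. p x \<theta>) \<in> borel_measurable (restrict_space \<mu> \<Xi>) \<and>
                       prob_space (model_distr \<mu> \<Xi> p \<theta>))"

text \<open>
  The exponential form is imposed on the interior of \<open>\<Theta>\<close> only: outside it the density is not
  positive, whereas the right-hand side is, wherever \<open>\<beta>\<close> is.
\<close>

definition exponential_family ::
  "'x set \<Rightarrow> (real ^ 'p) set \<Rightarrow> ('x \<Rightarrow> real ^ 'p \<Rightarrow> real) \<Rightarrow> ('x \<Rightarrow> real) \<Rightarrow> ('x \<Rightarrow> real ^ 'p) \<Rightarrow>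
   (real ^ 'p \<Rightarrow> real ^ 'p) \<Rightarrow> (real ^ 'p \<Rightarrow> real) \<Rightarrow> bool" where
  "exponential_family \<Xi> \<Theta> p \<beta> \<gamma> \<eta> A \<longleftrightarrow>
     (\<forall>x\<in>\<Xi>. \<beta> x \<ge> 0) \<and>
     (\<forall>x\<in>\<Xi>. \<forall>\<theta>\<in>interior \<Theta>. p x \<theta> = \<beta> x * exp (\<gamma> x \<bullet> \<eta> \<theta> - A \<theta>))"

definition score :: "('x \<Rightarrow> real ^ 'p \<Rightarrow> real) \<Rightarrow> real ^ 'p \<Rightarrow> 'x \<Rightarrow> real ^ 'p" where
  "score p \<theta> x = gradient (\<lambda>\<theta>'. ln (p x \<theta>')) \<theta>"

definition fisher_information ::
  "'x measure \<Rightarrow> 'x set \<Rightarrow> ('x \<Rightarrow> real ^ 'p \<Rightarrow> real) \<Rightarrow> real ^ 'p \<Rightarrow> real ^ 'p ^ 'p" where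
  "fisher_information \<mu> \<Xi> p \<theta> =
     (\<integral>x. outer_product (score p \<theta> x) (score p \<theta> x) \<partial>model_distr \<mu> \<Xi> p \<theta>)"

definition em_density ::
  "'x measure \<Rightarrow> 'x set \<Rightarrow> ('x \<Rightarrow> real ^ 'p \<Rightarrow> real) \<Rightarrow> ('x \<Rightarrow> real) \<Rightarrow> 'x \<Rightarrow> real ^ 'p \<Rightarrow> real" where
  "em_density \<mu> \<Xi> p G x \<theta>' = G x * p x \<theta>' / (\<integral>y. G y \<partial>model_distr \<mu> \<Xi> p \<theta>')"

definition em_integrand ::
  "'x measure \<Rightarrow> 'x set \<Rightarrow> ('x \<Rightarrow> real ^ 'p \<Rightarrow> real) \<Rightarrow> ('x \<Rightarrow> real) \<Rightarrow> real ^ 'p \<Rightarrow> real ^ 'p \<Rightarrow> 'x \<Rightarrow> real"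
  where
  "em_integrand \<mu> \<Xi> p G \<theta> \<theta>' x =
     em_density \<mu> \<Xi> p G x \<theta>' * ln (G x * p x \<theta> / em_density \<mu> \<Xi> p G x \<theta>')"

text \<open>The surrogate \<open>u(\<theta>|\<theta>')\<close>: the second parameter argument is the current iterate.\<close>

definition em_surrogate ::
  "'x measure \<Rightarrow> 'x set \<Rightarrow> ('x \<Rightarrow> real ^ 'p \<Rightarrow> real) \<Rightarrow> ('x \<Rightarrow> real) \<Rightarrow> real ^ 'p \<Rightarrow> real ^ 'p \<Rightarrow> real"
  where
  "em_surrogate \<mu> \<Xi> p G \<theta> \<theta>' = - (LINT x:\<Xi>|\<mu>. em_integrand \<mu> \<Xi> p G \<theta> \<theta>' x)"

end

theory Submission
  imports Defs
begin

text \<open>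
  Absorb \<open>\<Omega>\<close> into the parametrisation: with \<open>X = \<Omega> \<gamma>\<close> and natural parameter
  \<open>\<Omega>\<^sup>-\<^sup>T \<eta>\<close>, whose Jacobian is \<open>D = \<Omega>\<^sup>-\<^sup>T \<nabla>\<eta>\<close>, the density ratio of two members of the
  family is an exponential in \<open>X\<close> and the mean of \<open>X\<close> is \<open>\<theta>\<close>.  Expectations at \<open>\<theta>'\<close> are thus
  exponentially weighted expectations at \<open>\<theta>\<close>, finite for all natural parameters near that of
  \<open>\<theta>\<close>, so \<open>X\<close> has exponential moments and one may differentiate under the integral sign.
  Differentiating total mass \<open>1\<close> gives \<open>\<nabla>A(\<theta>) = D\<^sup>T \<theta>\<close>, hence the score \<open>D\<^sup>T (X - \<theta>)\<close>;
  differentiating \<open>E[X] = \<theta>\<close> gives \<open>V[X] D = 1\<close>.  As covariances are symmetric, so is \<open>D\<close>, and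
  the Fisher information is \<open>D\<^sup>T V[X] D = D\<close>.
  If \<open>m\<close> is the mean of \<open>X\<close> under the EM density at \<open>\<theta>'\<close>, the same differentiation gives
  \<open>\<nabla>f(\<theta>') = - D(\<theta>') (m - \<theta>')\<close> and \<open>\<nabla>u(\<theta>|\<theta>') = - D(\<theta>) (m - \<theta>)\<close>, so both the stationary
  point of the surrogate and the natural gradient step are \<open>m\<close>.
\<close>

section \<open>Exponential moments and differentiation under the integral sign\<close>

text \<open>Taylor expansion with Lagrange remainder. It is applied with
  \<open>s = h \<bullet> X x\<close>, where the right-hand side splits into \<open>norm h\<close>
  squared and an integrable bound free of \<open>h\<close>.\<close>

lemma exp_quadratic_remainder:
  fixes s :: real
  shows "\<bar>exp s - 1 - s\<bar> \<le> s\<^sup>2 * exp \<bar>s\<bar>"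
proof -
  obtain t where t: "\<bar>t\<bar> \<le> \<bar>s\<bar>" "exp s = (\<Sum>m<2. s ^ m / fact m) + exp t / fact 2 * s ^ 2"
    using Maclaurin_exp_le by blast
  then have "exp s - 1 - s = exp t / 2 * s\<^sup>2"
    by (simp add: numeral_2_eq_2)
  then have "\<bar>exp s - 1 - s\<bar> = exp t * (s\<^sup>2 / 2)"
    by (simp only: abs_mult) simp
  also have "\<dots> \<le> exp \<bar>s\<bar> * s\<^sup>2"
    using t(1) by (intro mult_mono) auto
  finally show ?thesis
    by (simp add: mult.commute)
qed

text \<open>In dimension \<open>n\<close> some coordinate of \<open>y\<close> has modulus at least
  \<open>norm y / n\<close>. Hence \<open>exp (d * norm y)\<close> is at most the sum of
  \<open>exp (h \<bullet> y)\<close> over the \<open>2 * n\<close> vectors \<open>h\<close> that are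
  plus or minus \<open>d * n\<close> times a basis vector, the sign of the coordinate selecting the
  relevant one.\<close>

lemma integrable_exp_norm:
  fixes X :: "'x \<Rightarrow> 'a::euclidean_space" and w :: "'x \<Rightarrow> real"
  assumes [measurable]: "X \<in> borel_measurable M" "w \<in> borel_measurable M"
    and w: "\<And>x. x \<in> space M \<Longrightarrow> 0 \<le> w x"
    and e: "0 < e"
    and int: "\<And>h. norm h < e \<Longrightarrow> integrable M (\<lambda>x. exp (h \<bullet> X x) * w x)"
  obtains d where "0 < d" "integrable M (\<lambda>x. exp (d * norm (X x)) * w x)"
proof -
  define n where "n = real DIM('a)"
  have n: "n > 0" unfolding n_def by simp
  \<comment> \<open>With this choice the vectors \<open>h\<close> have norm
    \<open>d * n = e / 2\<close>, inside the ball where \<open>int\<close> applies.\<close>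
  define d where "d = e / (2 * n)"
  have d: "0 < d" "d * n < e" "0 < d * n" using e n by (auto simp: d_def)
  have dom: "exp (d * norm y) \<le> (\<Sum>b\<in>Basis. exp (((d * n) *\<^sub>R b) \<bullet> y) + exp ((- (d * n) *\<^sub>R b) \<bullet> y))"
    for y :: 'a
  proof -
    have "\<exists>b\<in>Basis. norm y \<le> n * \<bar>y \<bullet> b\<bar>"
    proof (rule ccontr)
      assume "\<not> (\<exists>b\<in>Basis. norm y \<le> n * \<bar>y \<bullet> b\<bar>)"
      then have *: "\<bar>y \<bullet> b\<bar> < norm y / n" if "b \<in> Basis" for b
        using that n by (simp add: field_simps not_le)
      have "norm y \<le> (\<Sum>b\<in>Basis. \<bar>y \<bullet> b\<bar>)"
        by (rule norm_le_l1)
      also have "\<dots> < (\<Sum>b\<in>(Basis::'a set). norm y / n)"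
        using * by (intro sum_strict_mono) auto
      also have "\<dots> = norm y"
        using n by (simp add: n_def)
      finally show False by simp
    qed
    then obtain b :: 'a where b: "b \<in> Basis" "norm y \<le> n * \<bar>y \<bullet> b\<bar>"
      by blast
    have "exp (d * norm y) \<le> exp (d * n * \<bar>y \<bullet> b\<bar>)"
      using b(2) d by (simp add: mult.assoc)
    also have "\<dots> \<le> exp (((d * n) *\<^sub>R b) \<bullet> y) + exp ((- (d * n) *\<^sub>R b) \<bullet> y)"
      by (cases "0 \<le> y \<bullet> b") (auto simp: inner_commute[of y] abs_if)
    also have "\<dots> \<le> (\<Sum>b\<in>Basis. exp (((d * n) *\<^sub>R b) \<bullet> y) + exp ((- (d * n) *\<^sub>R b) \<bullet> y))"
      by (rule member_le_sum[OF b(1)]) (auto intro: add_nonneg_nonneg)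
    finally show ?thesis .
  qed
  have "integrable M (\<lambda>x. exp (d * norm (X x)) * w x)"
  proof (rule Bochner_Integration.integrable_bound)
    show "integrable M (\<lambda>x. \<Sum>b\<in>Basis. exp (((d * n) *\<^sub>R b) \<bullet> X x) * w x +
        exp ((- (d * n) *\<^sub>R b) \<bullet> X x) * w x)"
      using d by (intro Bochner_Integration.integrable_sum Bochner_Integration.integrable_add int) auto
    have "exp (d * norm (X x)) * w x \<le> (\<Sum>b\<in>Basis. exp (((d * n) *\<^sub>R b) \<bullet> X x) * w x +
        exp ((- (d * n) *\<^sub>R b) \<bullet> X x) * w x)" if "x \<in> space M" for x
      using mult_right_mono[OF dom w[OF that], of "X x"]
      by (simp only: sum_distrib_right ring_distribs)
    then show "AE x in M. norm (exp (d * norm (X x)) * w x) \<le>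
       norm (\<Sum>b\<in>Basis. exp (((d * n) *\<^sub>R b) \<bullet> X x) * w x + exp ((- (d * n) *\<^sub>R b) \<bullet> X x) * w x)"
      using w by (intro AE_I2) (simp add: order_trans[OF _ abs_ge_self])
  qed measurable
  with d(1) that show thesis by blast
qed

text \<open>Half of the exponent pays for one factor \<open>norm (X x)\<close>, since
  \<open>t\<close> is at most \<open>2 / d * exp (d / 2 * t)\<close>. Iterating the lemma yields any
  power of the norm.\<close>

lemma integrable_norm_times_exp_norm:
  fixes X :: "'x \<Rightarrow> 'a::euclidean_space" and w :: "'x \<Rightarrow> real"
  assumes [measurable]: "X \<in> borel_measurable M" "w \<in> borel_measurable M"
    and d: "0 < d"
    and int: "integrable M (\<lambda>x. exp (d * norm (X x)) * w x)"
  shows "integrable M (\<lambda>x. exp (d / 2 * norm (X x)) * (norm (X x) * w x))"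
proof (rule Bochner_Integration.integrable_bound)
  show "integrable M (\<lambda>x. 2 / d * (exp (d * norm (X x)) * w x))"
    using int by simp
  have "exp (d / 2 * t) * t \<le> 2 / d * exp (d * t)" for t
  proof -
    have "d / 2 * t \<le> exp (d / 2 * t)"
      using exp_ge_add_one_self[of "d / 2 * t"] by linarith
    then have "exp (d / 2 * t) * t \<le> exp (d / 2 * t) * (2 / d * exp (d / 2 * t))"
      using d by (intro mult_left_mono) (auto simp: field_simps)
    also have "\<dots> = 2 / d * (exp (d / 2 * t + d / 2 * t))"
      unfolding exp_add by simp
    finally show ?thesis by simp
  qed
  from mult_right_mono[OF this, of "\<bar>w x\<bar>" "norm (X x)" for x]
  show "AE x in M. norm (exp (d / 2 * norm (X x)) * (norm (X x) * w x)) \<le>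
      norm (2 / d * (exp (d * norm (X x)) * w x))"
    using d by (intro AE_I2) (simp add: abs_mult mult.assoc)
qed measurable

text \<open>The remainder of the integrand at \<open>h\<close> is at most \<open>norm h\<close>
  squared times an integrable \<open>B\<close>, so the error of the difference quotient is at most
  \<open>norm h\<close> times the integral of \<open>B\<close> and tends to 0.\<close>

lemma has_derivative_exp_moment:
  fixes X :: "'x \<Rightarrow> 'a::euclidean_space" and V :: "'x \<Rightarrow> 'c::{banach, second_countable_topology}"
  assumes [measurable]: "X \<in> borel_measurable M" "V \<in> borel_measurable M"
    and d: "0 < d"
    and int: "integrable M (\<lambda>x. exp (d * norm (X x)) * norm (V x))"
  shows "((\<lambda>h. \<integral>x. exp (h \<bullet> X x) *\<^sub>R V x \<partial>M) has_derivative (\<lambda>h. \<integral>x. (h \<bullet> X x) *\<^sub>R V x \<partial>M)) (at 0)"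
    and "integrable M (\<lambda>x. (h \<bullet> X x) *\<^sub>R V x)"
proof -
  have int1: "integrable M (\<lambda>x. exp (d / 2 * norm (X x)) * (norm (X x) * norm (V x)))"
    using d int by (intro integrable_norm_times_exp_norm) auto
  \<comment> \<open>Two factors of the norm are needed, one for each power of
    \<open>h \<bullet> X x\<close> in the remainder. Halving the exponent twice leaves
    \<open>d / 4\<close>, which is also the radius allowed for \<open>h\<close> below.\<close>
  define B where "B x = exp (d / 2 / 2 * norm (X x)) * (norm (X x) * (norm (X x) * norm (V x)))" for x
  have B: "integrable M B"
    unfolding B_def using d int1 by (intro integrable_norm_times_exp_norm[where d = "d / 2"]) auto
  have exp_le: "integrable M (\<lambda>x. exp (h \<bullet> X x) *\<^sub>R V x)" if "norm h \<le> d" for h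
  proof (rule Bochner_Integration.integrable_bound[OF int])
    have "h \<bullet> y \<le> d * norm y" for y
      using norm_cauchy_schwarz[of h y] mult_right_mono[OF that norm_ge_zero[of y]] by linarith
    then show "AE x in M. norm (exp (h \<bullet> X x) *\<^sub>R V x) \<le> norm (exp (d * norm (X x)) * norm (V x))"
      by (intro AE_I2) (simp add: mult_right_mono)
  qed measurable
  have lin: "integrable M (\<lambda>x. (h \<bullet> X x) *\<^sub>R V x)" for h
  proof (rule Bochner_Integration.integrable_bound)
    show "integrable M (\<lambda>x. norm h * (exp (d / 2 * norm (X x)) * (norm (X x) * norm (V x))))"
      using int1 by simp
    have "\<bar>h \<bullet> y\<bar> * v \<le> norm h * (exp (d / 2 * norm y) * (norm y * v))" if "0 \<le> v" for y v
    proof -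
      have "\<bar>h \<bullet> y\<bar> * v \<le> (norm h * norm y) * v"
        using that by (intro mult_right_mono Cauchy_Schwarz_ineq2)
      also have "\<dots> \<le> exp (d / 2 * norm y) * ((norm h * norm y) * v)"
        using mult_right_mono[of 1 "exp (d / 2 * norm y)" "norm h * norm y * v"] that d by simp
      finally show ?thesis by (simp add: mult_ac)
    qed
    then show "AE x in M. norm ((h \<bullet> X x) *\<^sub>R V x) \<le>
        norm (norm h * (exp (d / 2 * norm (X x)) * (norm (X x) * norm (V x))))"
      by (intro AE_I2) simp
  qed measurable
  show "integrable M (\<lambda>x. (h \<bullet> X x) *\<^sub>R V x)" by (rule lin)
  have V: "integrable M V"
    using exp_le[of 0] d by simp
  show "((\<lambda>h. \<integral>x. exp (h \<bullet> X x) *\<^sub>R V x \<partial>M) has_derivative (\<lambda>h. \<integral>x. (h \<bullet> X x) *\<^sub>R V x \<partial>M)) (at 0)"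
  proof (rule has_derivativeI_sandwich[where e = "d / 4" and H = "\<lambda>h. norm (h - 0) * integral\<^sup>L M B"])
    show "0 < d / 4" using d by simp
    show "bounded_linear (\<lambda>h. \<integral>x. (h \<bullet> X x) *\<^sub>R V x \<partial>M)"
      by (rule linear_conv_bounded_linear[THEN iffD1], rule linearI)
         (simp_all add: inner_add_left scaleR_add_left lin flip: scaleR_scaleR)
    show "((\<lambda>h. norm (h - 0) * integral\<^sup>L M B) \<longlongrightarrow> 0) (at 0)"
      by (auto intro!: tendsto_eq_intros)
    fix h :: 'a
    assume "h \<noteq> 0" "dist h 0 < d / 4"
    then have h: "0 < norm h" "norm h < d / 4" by auto
    have rem: "norm (exp (h \<bullet> X x) *\<^sub>R V x - V x - (h \<bullet> X x) *\<^sub>R V x) \<le> (norm h)\<^sup>2 * B x" for x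
    proof -
      let ?s = "h \<bullet> X x" and ?y = "norm (X x)"
      have "\<bar>?s\<bar> \<le> norm h * ?y"
        by (rule Cauchy_Schwarz_ineq2)
      moreover from this have "\<bar>?s\<bar> \<le> d / 2 / 2 * ?y"
        using mult_right_mono[of "norm h" "d/4" ?y] h by simp
      moreover have "?s\<^sup>2 \<le> (norm h * ?y)\<^sup>2"
        using \<open>\<bar>?s\<bar> \<le> norm h * ?y\<close> by (metis abs_ge_zero power2_abs power_mono)
      ultimately have "?s\<^sup>2 * exp \<bar>?s\<bar> \<le> (norm h * ?y)\<^sup>2 * exp (d / 2 / 2 * ?y)"
        by (intro mult_mono) auto
      with exp_quadratic_remainder[of ?s]
      have "\<bar>exp ?s - 1 - ?s\<bar> \<le> (norm h * ?y)\<^sup>2 * exp (d / 2 / 2 * ?y)" by linarith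
      then have "\<bar>exp ?s - 1 - ?s\<bar> * norm (V x) \<le> (norm h * ?y)\<^sup>2 * exp (d / 2 / 2 * ?y) * norm (V x)"
        by (rule mult_right_mono) simp
      moreover have "exp ?s *\<^sub>R V x - V x - ?s *\<^sub>R V x = (exp ?s - 1 - ?s) *\<^sub>R V x"
        by (simp add: algebra_simps)
      ultimately show ?thesis
        by (simp add: B_def power2_eq_square mult_ac)
    qed
    have ih: "integrable M (\<lambda>x. exp (h \<bullet> X x) *\<^sub>R V x)"
      using h d by (intro exp_le) linarith
    have "norm ((\<integral>x. exp (h \<bullet> X x) *\<^sub>R V x \<partial>M) - (\<integral>x. V x \<partial>M) - (\<integral>x. (h \<bullet> X x) *\<^sub>R V x \<partial>M))
      = norm (\<integral>x. exp (h \<bullet> X x) *\<^sub>R V x - V x - (h \<bullet> X x) *\<^sub>R V x \<partial>M)"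
      using ih V lin by simp
    also have "\<dots> \<le> (\<integral>x. norm (exp (h \<bullet> X x) *\<^sub>R V x - V x - (h \<bullet> X x) *\<^sub>R V x) \<partial>M)"
      by (rule integral_norm_bound)
    also have "\<dots> \<le> (\<integral>x. (norm h)\<^sup>2 * B x \<partial>M)"
      using ih V lin B rem by (intro integral_mono) auto
    finally show "norm ((\<integral>x. exp (h \<bullet> X x) *\<^sub>R V x \<partial>M) - (\<integral>x. exp (0 \<bullet> X x) *\<^sub>R V x \<partial>M)
        - (\<integral>x. ((h - 0) \<bullet> X x) *\<^sub>R V x \<partial>M)) / norm (h - 0) \<le> norm (h - 0) * integral\<^sup>L M B"
      using h by (simp add: divide_le_eq power2_eq_square mult_ac)
  qed
qed

section \<open>Outer products, bounded linear maps on matrices, and inverses\<close>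

lemma inner_transpose_matrix_vector:
  fixes A :: "real ^ 'n ^ 'm"
  shows "h \<bullet> (transpose A *v y) = (A *v h) \<bullet> y"
  by (simp add: transpose_matrix_vector inner_commute[of h] dot_lmul_matrix inner_commute[of y])

lemma outer_product_matrix_vector: "outer_product v w *v y = (w \<bullet> y) *\<^sub>R v"
  by (simp add: vec_eq_iff outer_product_def matrix_vector_mult_def inner_vec_def
      sum_distrib_left sum_distrib_right mult_ac)

lemma outer_product_matrix_matrix:
  "outer_product (A *v v) (B *v w) = A ** outer_product v w ** transpose B"
  by (simp add: vec_eq_iff outer_product_def matrix_vector_mult_def matrix_matrix_mult_def
      transpose_def sum_distrib_left sum_distrib_right mult_ac sum_product)

text \<open>Splitting into rows reduces integrability of a matrix-valued function to that of
  vector-valued ones, through \<open>bounded_linear_axis\<close>.\<close>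

lemma outer_product_eq_sum_axis: "outer_product v w = (\<Sum>i\<in>UNIV. axis i (v $ i *\<^sub>R w))"
  by (simp add: vec_eq_iff outer_product_def axis_def if_distrib [of "\<lambda>x. x $ _"] cong: if_cong)

lemma transpose_outer_product: "transpose (outer_product v w) = outer_product w v"
  by (simp add: vec_eq_iff outer_product_def transpose_def)

lemma bounded_linear_axis: "bounded_linear (axis i :: 'a::euclidean_space \<Rightarrow> 'a ^ 'n)"
  by (rule linear_conv_bounded_linear[THEN iffD1], rule linearI) (auto simp: axis_def vec_eq_iff)

lemma bounded_linear_matrix_vector_left:
  "bounded_linear (\<lambda>C :: real ^ 'n ^ 'm. C *v y)"
  by (rule linear_conv_bounded_linear[THEN iffD1], rule linearI)
     (auto simp: matrix_vector_mult_add_rdistrib scaleR_matrix_vector_assoc)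

lemma bounded_linear_matrix_conjugate:
  "bounded_linear (\<lambda>C :: real ^ 'n ^ 'm. (A :: real ^ 'm ^ 'k) ** C ** (B :: real ^ 'l ^ 'n))"
  by (rule linear_conv_bounded_linear[THEN iffD1], rule linearI)
     (auto simp: matrix_matrix_mult_def vec_eq_iff algebra_simps sum.distrib sum_distrib_left sum_distrib_right)

lemma bounded_linear_transpose: "bounded_linear (transpose :: real ^ 'n ^ 'm \<Rightarrow> real ^ 'm ^ 'n)"
  by (rule linear_conv_bounded_linear[THEN iffD1], rule linearI)
     (auto simp: transpose_def vec_eq_iff)

lemma invertible_transpose:
  fixes A :: "real ^ 'n ^ 'n"
  shows "invertible A \<Longrightarrow> invertible (transpose A)"
  by (simp add: invertible_det_nz det_transpose)

text \<open>A right inverse of a square matrix is two-sided, so the choice made in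
  \<open>matrix_inv\<close> is forced.\<close>

lemma matrix_inv_eqI:
  fixes A B :: "real ^ 'n ^ 'n"
  assumes "A ** B = mat 1"
  shows "matrix_inv A = B"
proof -
  have "B ** A = mat 1" using assms by (simp add: matrix_left_right_inverse)
  then have "A ** matrix_inv A = mat 1 \<and> matrix_inv A ** A = mat 1"
    unfolding matrix_inv_def using assms by (intro someI_ex[of "\<lambda>A'. A ** A' = mat 1 \<and> A' ** A = mat 1"]) blast
  then have "B ** (A ** matrix_inv A) = B" by simp
  then show ?thesis by (simp add: matrix_mul_assoc \<open>B ** A = mat 1\<close>)
qed

lemma invertible_matrix_inv:
  fixes A :: "real ^ 'n ^ 'n"
  assumes "invertible A"
  shows "A ** matrix_inv A = mat 1" "matrix_inv A ** A = mat 1"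
  using assms matrix_inv_eqI[of A] by (auto simp: invertible_def)

lemma integrable_scaleR_right_iff:
  fixes f :: "'x \<Rightarrow> 'c::{banach, second_countable_topology}"
  shows "c \<noteq> 0 \<Longrightarrow> integrable M (\<lambda>x. c *\<^sub>R f x) \<longleftrightarrow> integrable M f"
  using integrable_scaleR_right[of c M f] integrable_scaleR_right[of "inverse c" M "\<lambda>x. c *\<^sub>R f x"]
  by auto

section \<open>Exponential families with an unbiased statistic\<close>

text \<open>The family after \<open>\<Omega>\<close> has been absorbed: \<open>M\<close> is the
  reference measure on the support, \<open>U\<close> the parameter domain, \<open>D\<close> the
  Jacobian of the new natural parameter. The exponential form enters only as a ratio of densities;
  \<open>\<beta>\<close> cancels there, and any member can serve as reference for the
  others.\<close>

locale unbiased_exponential_family =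
  fixes M :: "'x measure"
    and U :: "(real ^ 'p) set"
    and p :: "'x \<Rightarrow> real ^ 'p \<Rightarrow> real"
    and X :: "'x \<Rightarrow> real ^ 'p"
    and \<eta> :: "real ^ 'p \<Rightarrow> real ^ 'p"
    and D :: "real ^ 'p \<Rightarrow> real ^ 'p ^ 'p"
    and A :: "real ^ 'p \<Rightarrow> real"
  assumes open_U: "open U"
    and X_measurable [measurable]: "X \<in> borel_measurable M"
    and p_measurable: "\<theta> \<in> U \<Longrightarrow> (\<lambda>x. p x \<theta>) \<in> borel_measurable M"
    and p_pos: "x \<in> space M \<Longrightarrow> \<theta> \<in> U \<Longrightarrow> 0 < p x \<theta>"
    and p_ratio: "x \<in> space M \<Longrightarrow> \<theta> \<in> U \<Longrightarrow> \<theta>' \<in> U \<Longrightarrow>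
        p x \<theta> = p x \<theta>' * exp ((\<eta> \<theta> - \<eta> \<theta>') \<bullet> X x - (A \<theta> - A \<theta>'))"
    and prob: "\<theta> \<in> U \<Longrightarrow> prob_space (density M (\<lambda>x. ennreal (p x \<theta>)))"
    and \<eta>_derivative: "\<theta> \<in> U \<Longrightarrow> (\<eta> has_derivative (*v) (D \<theta>)) (at \<theta>)"
    and D_invertible: "\<theta> \<in> U \<Longrightarrow> invertible (D \<theta>)"
    and X_integrable: "\<theta> \<in> U \<Longrightarrow> integrable (density M (\<lambda>x. ennreal (p x \<theta>))) X"
    and X_mean: "\<theta> \<in> U \<Longrightarrow> (\<integral>x. X x \<partial>density M (\<lambda>x. ennreal (p x \<theta>))) = \<theta>"
begin

abbreviation P :: "real ^ 'p \<Rightarrow> 'x measure" where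
  "P \<theta> \<equiv> density M (\<lambda>x. ennreal (p x \<theta>))"

text \<open>Exponential tilting: \<open>p_ratio\<close> gives \<open>P \<theta>\<close> the density
  \<open>exp (A \<theta>' - A \<theta>)\<close> times
  \<open>exp ((\<eta> \<theta> - \<eta> \<theta>') \<bullet> X x)\<close> with respect to
  \<open>P \<theta>'\<close>. The parameter thus moves from the measure into the integrand, where it
  can be differentiated.\<close>

lemma
  fixes g :: "'x \<Rightarrow> 'c::{banach, second_countable_topology}"
  assumes [measurable]: "g \<in> borel_measurable M" and \<theta>: "\<theta> \<in> U" "\<theta>' \<in> U"
  shows integrable_change_parameter:
      "integrable (P \<theta>) g \<longleftrightarrow> integrable (P \<theta>') (\<lambda>x. exp ((\<eta> \<theta> - \<eta> \<theta>') \<bullet> X x) *\<^sub>R g x)"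
    and integral_change_parameter:
      "(\<integral>x. g x \<partial>P \<theta>) = exp (A \<theta>' - A \<theta>) *\<^sub>R (\<integral>x. exp ((\<eta> \<theta> - \<eta> \<theta>') \<bullet> X x) *\<^sub>R g x \<partial>P \<theta>')"
proof -
  note [measurable] = p_measurable[OF \<theta>(1)] p_measurable[OF \<theta>(2)]
  have nn: "AE x in M. 0 \<le> p x \<theta>" "AE x in M. 0 \<le> p x \<theta>'"
    using p_pos \<theta> by (auto intro!: AE_I2 less_imp_le)
  have eq: "p x \<theta> *\<^sub>R g x = exp (A \<theta>' - A \<theta>) *\<^sub>R (p x \<theta>' *\<^sub>R (exp ((\<eta> \<theta> - \<eta> \<theta>') \<bullet> X x) *\<^sub>R g x))"
    if "x \<in> space M" for x
  proof -
    have "p x \<theta> = exp (A \<theta>' - A \<theta>) * (p x \<theta>' * exp ((\<eta> \<theta> - \<eta> \<theta>') \<bullet> X x))"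
      using p_ratio[OF that \<theta>] by (simp add: exp_diff)
    then show ?thesis by simp
  qed
  have "integrable (P \<theta>) g \<longleftrightarrow> integrable M (\<lambda>x. p x \<theta> *\<^sub>R g x)"
    using nn by (intro integrable_density) auto
  also have "\<dots> \<longleftrightarrow> integrable M (\<lambda>x. exp (A \<theta>' - A \<theta>) *\<^sub>R (p x \<theta>' *\<^sub>R (exp ((\<eta> \<theta> - \<eta> \<theta>') \<bullet> X x) *\<^sub>R g x)))"
    by (intro Bochner_Integration.integrable_cong eq refl)
  also have "\<dots> \<longleftrightarrow> integrable M (\<lambda>x. p x \<theta>' *\<^sub>R (exp ((\<eta> \<theta> - \<eta> \<theta>') \<bullet> X x) *\<^sub>R g x))"
    by (intro integrable_scaleR_right_iff) simp
  also have "\<dots> \<longleftrightarrow> integrable (P \<theta>') (\<lambda>x. exp ((\<eta> \<theta> - \<eta> \<theta>') \<bullet> X x) *\<^sub>R g x)"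
    using nn by (intro integrable_density[symmetric]) auto
  finally show "integrable (P \<theta>) g \<longleftrightarrow> integrable (P \<theta>') (\<lambda>x. exp ((\<eta> \<theta> - \<eta> \<theta>') \<bullet> X x) *\<^sub>R g x)" .
  have "(\<integral>x. g x \<partial>P \<theta>) = (\<integral>x. p x \<theta> *\<^sub>R g x \<partial>M)"
    using nn by (intro integral_density) auto
  also have "\<dots> = (\<integral>x. exp (A \<theta>' - A \<theta>) *\<^sub>R (p x \<theta>' *\<^sub>R (exp ((\<eta> \<theta> - \<eta> \<theta>') \<bullet> X x) *\<^sub>R g x)) \<partial>M)"
    by (intro Bochner_Integration.integral_cong eq refl)
  also have "\<dots> = exp (A \<theta>' - A \<theta>) *\<^sub>R (\<integral>x. p x \<theta>' *\<^sub>R (exp ((\<eta> \<theta> - \<eta> \<theta>') \<bullet> X x) *\<^sub>R g x) \<partial>M)"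
    by (rule integral_scaleR_right)
  also have "(\<integral>x. p x \<theta>' *\<^sub>R (exp ((\<eta> \<theta> - \<eta> \<theta>') \<bullet> X x) *\<^sub>R g x) \<partial>M) =
      (\<integral>x. exp ((\<eta> \<theta> - \<eta> \<theta>') \<bullet> X x) *\<^sub>R g x \<partial>P \<theta>')"
    using nn by (intro integral_density[symmetric]) auto
  finally show "(\<integral>x. g x \<partial>P \<theta>) =
      exp (A \<theta>' - A \<theta>) *\<^sub>R (\<integral>x. exp ((\<eta> \<theta> - \<eta> \<theta>') \<bullet> X x) *\<^sub>R g x \<partial>P \<theta>')" .
qed

text \<open>\<open>\<eta>\<close> is not assumed to be \<open>C\<^sup>1\<close>, so the inverse function theorem is unavailable;
  Brouwer's theorem still makes \<open>\<eta> ` U\<close> a neighbourhood of each \<open>\<eta> \<theta>\<close>.\<close>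

lemma natural_parameter_neighbourhood:
  assumes "\<theta> \<in> U"
  obtains e where "0 < e" "\<And>h. norm h < e \<Longrightarrow> \<exists>\<theta>'\<in>U. \<eta> \<theta>' - \<eta> \<theta> = h"
proof -
  obtain B where B: "D \<theta> ** B = mat 1"
    using D_invertible[OF assms] by (auto simp: invertible_def)
  have "\<eta> \<theta> \<in> interior (\<eta> ` U)"
  proof (rule sussmann_open_mapping[OF open_U _ assms \<eta>_derivative[OF assms]])
    show "continuous_on U \<eta>"
      by (meson \<eta>_derivative continuous_at_imp_continuous_on has_derivative_continuous)
    show "bounded_linear ((*v) B)" by (rule matrix_vector_mul_bounded_linear)
    show "(*v) (D \<theta>) \<circ> (*v) B = id"
      by (auto simp: fun_eq_iff matrix_vector_mul_assoc B)
    show "\<theta> \<in> interior U" using assms open_U by (simp add: interior_open)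
  qed simp
  then obtain e where "0 < e" and e: "ball (\<eta> \<theta>) e \<subseteq> \<eta> ` U"
    by (auto simp: mem_interior)
  show thesis
  proof (rule that[OF \<open>0 < e\<close>])
    fix h :: "real ^ 'p" assume "norm h < e"
    then have "\<eta> \<theta> + h \<in> ball (\<eta> \<theta>) e" by (simp add: dist_norm)
    with e show "\<exists>\<theta>'\<in>U. \<eta> \<theta>' - \<eta> \<theta> = h"
      by (metis add_diff_cancel_left' imageE subsetD)
  qed
qed

text \<open>Every small \<open>h\<close> is a displacement
  \<open>\<eta> \<theta>' - \<eta> \<theta>\<close> with \<open>\<theta>'\<close> in
  \<open>U\<close>. Integrability of \<open>w\<close> at \<open>\<theta>'\<close>, transferred to
  \<open>\<theta>\<close>, is integrability of \<open>w\<close> tilted by \<open>h\<close>, as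
  \<open>integrable_exp_norm\<close> requires.\<close>

lemma exponential_moment:
  fixes w :: "'x \<Rightarrow> real"
  assumes [measurable]: "w \<in> borel_measurable M"
    and w: "\<And>x. x \<in> space M \<Longrightarrow> 0 \<le> w x"
    and int: "\<And>\<theta>. \<theta> \<in> U \<Longrightarrow> integrable (P \<theta>) w"
    and \<theta>: "\<theta> \<in> U"
  obtains d where "0 < d" "integrable (P \<theta>) (\<lambda>x. exp (d * norm (X x)) * w x)"
proof -
  obtain e where e: "0 < e" "\<And>h. norm h < e \<Longrightarrow> \<exists>\<theta>'\<in>U. \<eta> \<theta>' - \<eta> \<theta> = h"
    using natural_parameter_neighbourhood[OF \<theta>] by metis
  show thesis
  proof (rule integrable_exp_norm[where M = "P \<theta>" and X = X and w = w, OF _ _ _ e(1) _ that])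
    fix h :: "real ^ 'p" assume "norm h < e"
    with e(2) obtain \<theta>' where "\<theta>' \<in> U" "\<eta> \<theta>' - \<eta> \<theta> = h" by blast
    with integrable_change_parameter[of w \<theta>' \<theta>] int \<theta>
    show "integrable (P \<theta>) (\<lambda>x. exp (h \<bullet> X x) * w x)" by simp
  qed (use w in auto)
qed

text \<open>Chain rule through \<open>\<eta>\<close>: the measure stays fixed at
  \<open>P \<theta>\<close>, and the displacement \<open>\<eta> \<theta>' - \<eta> \<theta>\<close>
  is 0 at \<open>\<theta>' = \<theta>\<close>.\<close>

lemma has_derivative_moment:
  fixes V :: "'x \<Rightarrow> 'c::{banach, second_countable_topology}"
  assumes [measurable]: "V \<in> borel_measurable M" and \<theta>: "\<theta> \<in> U" and d: "0 < d"
    and int: "integrable (P \<theta>) (\<lambda>x. exp (d * norm (X x)) * norm (V x))"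
  shows "((\<lambda>\<theta>'. \<integral>x. exp ((\<eta> \<theta>' - \<eta> \<theta>) \<bullet> X x) *\<^sub>R V x \<partial>P \<theta>) has_derivative
      (\<lambda>v. \<integral>x. ((D \<theta> *v v) \<bullet> X x) *\<^sub>R V x \<partial>P \<theta>)) (at \<theta>)"
proof -
  have 1: "((\<lambda>\<theta>'. \<eta> \<theta>' - \<eta> \<theta>) has_derivative (*v) (D \<theta>)) (at \<theta>)"
    using has_derivative_diff[OF \<eta>_derivative[OF \<theta>] has_derivative_const] by simp
  have 2: "((\<lambda>h. \<integral>x. exp (h \<bullet> X x) *\<^sub>R V x \<partial>P \<theta>) has_derivative
      (\<lambda>h. \<integral>x. (h \<bullet> X x) *\<^sub>R V x \<partial>P \<theta>)) (at (\<eta> \<theta> - \<eta> \<theta>))"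
    using has_derivative_exp_moment(1)[OF _ _ d int] by simp
  show ?thesis
    using has_derivative_compose[OF 1 2] .
qed

lemma bounded_exponential_moment:
  assumes "\<theta> \<in> U"
  obtains d where "0 < d" "integrable (P \<theta>) (\<lambda>x. exp (d * norm (X x)))"
proof -
  have 1: "integrable (P \<theta>) (\<lambda>x. 1::real)" if "\<theta> \<in> U" for \<theta>
  proof -
    interpret prob_space "P \<theta>" using that by (rule prob)
    show ?thesis by simp
  qed
  obtain d where "0 < d" "integrable (P \<theta>) (\<lambda>x. exp (d * norm (X x)) * 1)"
    by (rule exponential_moment[of "\<lambda>_. 1" \<theta>, OF _ _ 1 assms]) auto
  with that show thesis by simp
qed

text \<open>As \<open>P \<theta>'\<close> has mass one, the tilted mass \<open>K \<theta>'\<close>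
  equals \<open>exp (A \<theta>' - A \<theta>)\<close> on \<open>U\<close>, so \<open>A\<close>
  inherits differentiability from \<open>ln K\<close>. The derivative of \<open>K\<close> at
  \<open>\<theta>\<close> involves only the mean of \<open>X\<close>, which is
  \<open>\<theta>\<close>.\<close>

lemma log_partition_derivative:
  assumes \<theta>: "\<theta> \<in> U"
  shows "(A has_derivative (\<lambda>v. (D \<theta> *v v) \<bullet> \<theta>)) (at \<theta>)"
proof -
  obtain d where d: "0 < d" "integrable (P \<theta>) (\<lambda>x. exp (d * norm (X x)))"
    using bounded_exponential_moment[OF \<theta>] .
  define K where "K \<theta>' = (\<integral>x. exp ((\<eta> \<theta>' - \<eta> \<theta>) \<bullet> X x) \<partial>P \<theta>)" for \<theta>'
  have K: "(K has_derivative (\<lambda>v. (D \<theta> *v v) \<bullet> \<theta>)) (at \<theta>)"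
    using has_derivative_moment[of "\<lambda>_. 1::real", OF _ \<theta> d(1)] d(2) X_mean[OF \<theta>] X_integrable[OF \<theta>]
    unfolding K_def[abs_def] by simp
  have K_eq: "K \<theta>' = exp (A \<theta>' - A \<theta>)" if "\<theta>' \<in> U" for \<theta>'
  proof -
    interpret P': prob_space "P \<theta>'" using that by (rule prob)
    show ?thesis
      using integral_change_parameter[of "\<lambda>_. 1::real" \<theta>' \<theta>] that \<theta> P'.prob_space
      by (simp add: K_def exp_diff field_simps)
  qed
  have "((\<lambda>\<theta>'. A \<theta> + ln (K \<theta>')) has_derivative (\<lambda>v. (D \<theta> *v v) \<bullet> \<theta>)) (at \<theta>)"
    using K_eq[OF \<theta>] by (auto intro!: derivative_eq_intros K)
  then show ?thesis
    by (rule has_derivative_transform_within_open[OF _ open_U \<theta>]) (simp add: K_eq)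
qed

text \<open>The tilted integral of \<open>X\<close> is differentiated in two ways: under the
  integral sign, and from its closed form
  \<open>exp (A \<theta>' - A \<theta>) *\<^sub>R \<theta>'\<close> supplied by unbiasedness at
  every \<open>\<theta>'\<close>. Uniqueness of the derivative equates the results.\<close>

lemma second_moment:
  assumes \<theta>: "\<theta> \<in> U"
  shows "integrable (P \<theta>) (\<lambda>x. (h \<bullet> X x) *\<^sub>R X x)"
    and "(\<integral>x. ((D \<theta> *v v) \<bullet> X x) *\<^sub>R X x \<partial>P \<theta>) = ((D \<theta> *v v) \<bullet> \<theta>) *\<^sub>R \<theta> + v"
proof -
  obtain d where d: "0 < d" "integrable (P \<theta>) (\<lambda>x. exp (d * norm (X x)))"
    using bounded_exponential_moment[OF \<theta>] .
  then have d2: "integrable (P \<theta>) (\<lambda>x. exp (d / 2 * norm (X x)) * norm (X x))"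
    using integrable_norm_times_exp_norm[of X "P \<theta>" "\<lambda>_. 1" d] by simp
  show "integrable (P \<theta>) (\<lambda>x. (h \<bullet> X x) *\<^sub>R X x)"
    using d by (intro has_derivative_exp_moment(2)[OF _ _ _ d2]) auto
  have "((\<lambda>\<theta>'. \<integral>x. exp ((\<eta> \<theta>' - \<eta> \<theta>) \<bullet> X x) *\<^sub>R X x \<partial>P \<theta>) has_derivative
      (\<lambda>v. \<integral>x. ((D \<theta> *v v) \<bullet> X x) *\<^sub>R X x \<partial>P \<theta>)) (at \<theta>)"
    using d by (intro has_derivative_moment[OF _ \<theta> _ d2]) auto
  moreover have "((\<lambda>\<theta>'. \<integral>x. exp ((\<eta> \<theta>' - \<eta> \<theta>) \<bullet> X x) *\<^sub>R X x \<partial>P \<theta>) has_derivative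
      (\<lambda>v. ((D \<theta> *v v) \<bullet> \<theta>) *\<^sub>R \<theta> + v)) (at \<theta>)"
  proof (rule has_derivative_transform_within_open[OF _ open_U \<theta>])
    show "((\<lambda>\<theta>'. exp (A \<theta>' - A \<theta>) *\<^sub>R \<theta>') has_derivative (\<lambda>v. ((D \<theta> *v v) \<bullet> \<theta>) *\<^sub>R \<theta> + v)) (at \<theta>)"
      by (auto intro!: derivative_eq_intros log_partition_derivative[OF \<theta>] simp: fun_eq_iff add.commute)
    show "exp (A \<theta>' - A \<theta>) *\<^sub>R \<theta>' = (\<integral>x. exp ((\<eta> \<theta>' - \<eta> \<theta>) \<bullet> X x) *\<^sub>R X x \<partial>P \<theta>)" if "\<theta>' \<in> U" for \<theta>'
      using arg_cong[OF integral_change_parameter[of X \<theta>' \<theta>], of "(*\<^sub>R) (exp (A \<theta>' - A \<theta>))"]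
        that \<theta> X_mean[OF that] by (simp add: exp_add[symmetric])
  qed
  ultimately have "(\<lambda>v. \<integral>x. ((D \<theta> *v v) \<bullet> X x) *\<^sub>R X x \<partial>P \<theta>) = (\<lambda>v. ((D \<theta> *v v) \<bullet> \<theta>) *\<^sub>R \<theta> + v)"
    by (rule has_derivative_unique)
  then show "(\<integral>x. ((D \<theta> *v v) \<bullet> X x) *\<^sub>R X x \<partial>P \<theta>) = ((D \<theta> *v v) \<bullet> \<theta>) *\<^sub>R \<theta> + v"
    by (rule fun_cong)
qed

text \<open>Expanding around the mean subtracts exactly the rank-one term
  \<open>(h \<bullet> \<theta>) *\<^sub>R \<theta>\<close> from the second moment in direction
  \<open>h\<close>.\<close>

lemma centered_second_moment:
  assumes \<theta>: "\<theta> \<in> U"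
  shows "integrable (P \<theta>) (\<lambda>x. (h \<bullet> (X x - \<theta>)) *\<^sub>R (X x - \<theta>))"
    and "(\<integral>x. ((D \<theta> *v v) \<bullet> (X x - \<theta>)) *\<^sub>R (X x - \<theta>) \<partial>P \<theta>) = v"
proof -
  interpret prob_space "P \<theta>" using \<theta> by (rule prob)
  note int [simp] = second_moment(1)[OF \<theta>] X_integrable[OF \<theta>]
  have eq: "(h \<bullet> (X x - \<theta>)) *\<^sub>R (X x - \<theta>) =
      (h \<bullet> X x) *\<^sub>R X x - (h \<bullet> X x) *\<^sub>R \<theta> - (h \<bullet> \<theta>) *\<^sub>R X x + (h \<bullet> \<theta>) *\<^sub>R \<theta>" for h x
    by (simp add: inner_diff_right algebra_simps)
  show "integrable (P \<theta>) (\<lambda>x. (h \<bullet> (X x - \<theta>)) *\<^sub>R (X x - \<theta>))"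
    unfolding eq by simp
  show "(\<integral>x. ((D \<theta> *v v) \<bullet> (X x - \<theta>)) *\<^sub>R (X x - \<theta>) \<partial>P \<theta>) = v"
    unfolding eq using prob_space by (simp add: second_moment(2)[OF \<theta>] X_mean[OF \<theta>])
qed

text \<open>Taking \<open>h = axis i 1\<close> in \<open>centered_second_moment\<close> gives the
  \<open>i\<close>-th row.\<close>

lemma integrable_outer_product:
  assumes \<theta>: "\<theta> \<in> U"
  shows "integrable (P \<theta>) (\<lambda>x. outer_product (X x - \<theta>) (X x - \<theta>))"
proof -
  have "integrable (P \<theta>) (\<lambda>x. axis i ((X x - \<theta>) $ i *\<^sub>R (X x - \<theta>)) :: real ^ 'p ^ 'p)" for i
    using integrable_bounded_linear[OF bounded_linear_axis centered_second_moment(1)[OF \<theta>, of "axis i 1"]]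
    by (simp add: inner_axis')
  then show ?thesis
    unfolding outer_product_eq_sum_axis by simp
qed

text \<open>An outer product \<open>y y\<close> applied to \<open>h\<close> is
  \<open>(h \<bullet> y) *\<^sub>R y\<close>, so applying the covariance to
  \<open>D \<theta> *v v\<close> gives the centered second moment in that direction, which is
  \<open>v\<close>.\<close>

lemma covariance_times_jacobian:
  assumes \<theta>: "\<theta> \<in> U"
  shows "covariance_matrix (P \<theta>) X ** D \<theta> = mat 1"
proof -
  have "covariance_matrix (P \<theta>) X *v (D \<theta> *v v) = v" for v
  proof -
    have "covariance_matrix (P \<theta>) X *v (D \<theta> *v v) =
        (\<integral>x. outer_product (X x - \<theta>) (X x - \<theta>) *v (D \<theta> *v v) \<partial>P \<theta>)"
      unfolding covariance_matrix_def X_mean[OF \<theta>]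
      by (rule integral_bounded_linear[OF bounded_linear_matrix_vector_left integrable_outer_product[OF \<theta>], symmetric])
    also have "\<dots> = v"
      using centered_second_moment(2)[OF \<theta>] by (simp add: outer_product_matrix_vector inner_commute)
    finally show ?thesis .
  qed
  then show ?thesis
    by (simp add: matrix_eq matrix_vector_mul_assoc)
qed

text \<open>Transposing the previous identity, with a symmetric covariance, makes
  \<open>transpose (D \<theta>)\<close> a left inverse of the covariance, while
  \<open>D \<theta>\<close> is a right inverse. The two therefore agree.\<close>

lemma transpose_jacobian:
  assumes \<theta>: "\<theta> \<in> U"
  shows "transpose (D \<theta>) = D \<theta>"
proof -
  let ?C = "covariance_matrix (P \<theta>) X"
  have "transpose ?C = ?C"
    unfolding covariance_matrix_def X_mean[OF \<theta>]
    using integral_bounded_linear[OF bounded_linear_transpose integrable_outer_product[OF \<theta>]]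
    by (simp add: transpose_outer_product)
  then have "transpose (D \<theta>) ** ?C = mat 1"
    by (metis covariance_times_jacobian[OF \<theta>] matrix_transpose_mul transpose_mat)
  then have "transpose (D \<theta>) ** (?C ** D \<theta>) = D \<theta>"
    by (simp add: matrix_mul_assoc)
  then show ?thesis
    by (simp add: covariance_times_jacobian[OF \<theta>])
qed

text \<open>By \<open>p_ratio\<close>, \<open>ln (p x \<theta>')\<close> differs from a constant by
  \<open>\<eta> \<theta>' \<bullet> X x - A \<theta>'\<close>. The second term contributes
  \<open>\<theta>\<close> by \<open>log_partition_derivative\<close>, which centers the
  score.\<close>

lemma score_eq:
  assumes x: "x \<in> space M" and \<theta>: "\<theta> \<in> U"
  shows "score p \<theta> x = transpose (D \<theta>) *v (X x - \<theta>)"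
  unfolding score_def
proof (rule gradient_eqI, unfold gderiv_def, rule has_derivative_transform_within_open[OF _ open_U \<theta>])
  show "((\<lambda>\<theta>'. ln (p x \<theta>) + ((\<eta> \<theta>' - \<eta> \<theta>) \<bullet> X x - (A \<theta>' - A \<theta>))) has_derivative
      (\<lambda>h. h \<bullet> (transpose (D \<theta>) *v (X x - \<theta>)))) (at \<theta>)"
    unfolding inner_transpose_matrix_vector
    by (auto intro!: derivative_eq_intros log_partition_derivative[OF \<theta>] \<eta>_derivative[OF \<theta>]
        simp: fun_eq_iff inner_diff_right)
  show "ln (p x \<theta>) + ((\<eta> \<theta>' - \<eta> \<theta>) \<bullet> X x - (A \<theta>' - A \<theta>)) = ln (p x \<theta>')" if "\<theta>' \<in> U" for \<theta>'
    using p_ratio[OF x that \<theta>] p_pos[OF x \<theta>] by (simp add: ln_mult)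
qed

text \<open>The score is linear in \<open>X x - \<theta>\<close>, so its outer product is a
  conjugate of the centered one. Integration gives the covariance between
  \<open>transpose (D \<theta>)\<close> and \<open>D \<theta>\<close>; the latter cancels it, and
  symmetry of \<open>D \<theta>\<close> finishes.\<close>

lemma fisher_information_integral:
  assumes \<theta>: "\<theta> \<in> U"
  shows "integrable (P \<theta>) (\<lambda>x. outer_product (score p \<theta> x) (score p \<theta> x))"
    and "(\<integral>x. outer_product (score p \<theta> x) (score p \<theta> x) \<partial>P \<theta>) = D \<theta>"
proof -
  let ?O = "\<lambda>x. outer_product (X x - \<theta>) (X x - \<theta>)"
  have eq: "outer_product (score p \<theta> x) (score p \<theta> x) = transpose (D \<theta>) ** ?O x ** D \<theta>"
    if "x \<in> space (P \<theta>)" for x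
    using that by (simp add: score_eq[OF _ \<theta>] outer_product_matrix_matrix del: transpose_matrix_vector)
  show "integrable (P \<theta>) (\<lambda>x. outer_product (score p \<theta> x) (score p \<theta> x))"
    using integrable_bounded_linear[OF bounded_linear_matrix_conjugate integrable_outer_product[OF \<theta>]]
    by (subst Bochner_Integration.integrable_cong[OF refl eq]) 
  have "(\<integral>x. outer_product (score p \<theta> x) (score p \<theta> x) \<partial>P \<theta>) = (\<integral>x. transpose (D \<theta>) ** ?O x ** D \<theta> \<partial>P \<theta>)"
    by (rule Bochner_Integration.integral_cong[OF refl eq])
  also have "\<dots> = transpose (D \<theta>) ** (\<integral>x. ?O x \<partial>P \<theta>) ** D \<theta>"
    by (rule integral_bounded_linear[OF bounded_linear_matrix_conjugate integrable_outer_product[OF \<theta>]])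
  also have "(\<integral>x. ?O x \<partial>P \<theta>) = covariance_matrix (P \<theta>) X"
    by (simp add: covariance_matrix_def X_mean[OF \<theta>])
  also have "transpose (D \<theta>) ** covariance_matrix (P \<theta>) X ** D \<theta> = D \<theta>"
    by (simp add: matrix_mul_assoc[symmetric] covariance_times_jacobian[OF \<theta>] transpose_jacobian[OF \<theta>])
  finally show "(\<integral>x. outer_product (score p \<theta> x) (score p \<theta> x) \<partial>P \<theta>) = D \<theta>" .
qed

lemma inner_jacobian:
  assumes "\<theta> \<in> U"
  shows "h \<bullet> (D \<theta> *v y) = (D \<theta> *v h) \<bullet> y"
  using inner_transpose_matrix_vector[of h "D \<theta>" y] by (simp only: transpose_jacobian[OF assms])

end

section \<open>The weight \<open>G\<close>, the objective and the EM surrogate\<close>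

locale weighted_unbiased_exponential_family = unbiased_exponential_family M U p X \<eta> D A
  for M :: "'x measure" and U :: "(real ^ 'p) set" and p X \<eta> D A +
  fixes G :: "'x \<Rightarrow> real"
  assumes G_measurable [measurable]: "G \<in> borel_measurable M"
    and G_pos: "x \<in> space M \<Longrightarrow> 0 < G x"
    and G_integrable: "\<theta> \<in> U \<Longrightarrow> integrable (P \<theta>) G"
begin

definition weight :: "real ^ 'p \<Rightarrow> real" where
  "weight \<theta> = (\<integral>x. G x \<partial>P \<theta>)"

text \<open>This is the mean of \<open>X\<close> under the EM density at \<open>\<theta>\<close>; it
  turns out to be the next iterate from \<open>\<theta>\<close>.\<close>

definition tilted_mean :: "real ^ 'p \<Rightarrow> real ^ 'p" where
  "tilted_mean \<theta> = (1 / weight \<theta>) *\<^sub>R (\<integral>x. G x *\<^sub>R X x \<partial>P \<theta>)"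

text \<open>A vanishing integral would force the strictly positive \<open>G\<close> to be 0 almost
  everywhere, impossible under a probability measure.\<close>

lemma weight_pos:
  assumes "\<theta> \<in> U"
  shows "0 < weight \<theta>"
proof -
  interpret prob_space "P \<theta>" using assms by (rule prob)
  have nn: "AE x in P \<theta>. 0 \<le> G x"
    using G_pos by (auto intro!: AE_I2 less_imp_le)
  have "weight \<theta> \<noteq> 0"
  proof
    assume "weight \<theta> = 0"
    then have "AE x in P \<theta>. G x = 0"
      using integral_nonneg_eq_0_iff_AE[OF G_integrable[OF assms] nn] by (simp add: weight_def)
    then have "AE x in P \<theta>. False"
      by (rule AE_mp) (use G_pos in \<open>force intro: AE_I2\<close>)
    then show False by simp
  qed
  then show ?thesis
    using integral_nonneg_AE[OF nn] by (simp add: weight_def)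
qed

text \<open>Integrability of \<open>G\<close> at all parameters yields exponential moments weighted
  by \<open>G\<close>. Near \<open>\<theta>\<close> the weight is
  \<open>exp (A \<theta> - A \<theta>')\<close> times a tilted integral of \<open>G\<close>; in the
  product rule the first factor contributes \<open>- \<theta>\<close> and the second
  \<open>tilted_mean \<theta>\<close>.\<close>

lemma
  assumes \<theta>: "\<theta> \<in> U"
  shows integrable_weighted: "integrable (P \<theta>) (\<lambda>x. G x *\<^sub>R X x)"
    and weight_derivative: "(weight has_derivative
        (\<lambda>v. weight \<theta> * ((D \<theta> *v v) \<bullet> (tilted_mean \<theta> - \<theta>)))) (at \<theta>)"
proof -
  obtain d where d: "0 < d" "integrable (P \<theta>) (\<lambda>x. exp (d * norm (X x)) * G x)"
    using exponential_moment[OF G_measurable less_imp_le[OF G_pos] G_integrable \<theta>] .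
  show int: "integrable (P \<theta>) (\<lambda>x. G x *\<^sub>R X x)"
  proof (rule Bochner_Integration.integrable_bound)
    show "integrable (P \<theta>) (\<lambda>x. exp (d / 2 * norm (X x)) * (norm (X x) * G x))"
      using d by (intro integrable_norm_times_exp_norm) auto
    have "\<bar>G x\<bar> * norm (X x) \<le> exp (d / 2 * norm (X x)) * (\<bar>G x\<bar> * norm (X x))" for x
      using mult_right_mono[of 1 "exp (d / 2 * norm (X x))" "\<bar>G x\<bar> * norm (X x)"] d by simp
    then show "AE x in P \<theta>. norm (G x *\<^sub>R X x) \<le> norm (exp (d / 2 * norm (X x)) * (norm (X x) * G x))"
      by (intro AE_I2) (simp add: abs_mult mult_ac)
  qed measurable
  have "integrable (P \<theta>) (\<lambda>x. exp (d * norm (X x)) * norm (G x))"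
    using d(2) G_pos by (subst Bochner_Integration.integrable_cong[OF refl, of _ _ "\<lambda>x. exp (d * norm (X x)) * G x"])
      (auto simp: less_imp_le)
  note has_derivative_moment[OF G_measurable \<theta> d(1) this]
  moreover have "(\<integral>x. (h \<bullet> X x) *\<^sub>R G x \<partial>P \<theta>) = h \<bullet> (weight \<theta> *\<^sub>R tilted_mean \<theta>)" for h
  proof -
    have "(\<integral>x. (h \<bullet> X x) *\<^sub>R G x \<partial>P \<theta>) = (\<integral>x. h \<bullet> (G x *\<^sub>R X x) \<partial>P \<theta>)"
      by (simp add: mult.commute)
    also have "\<dots> = h \<bullet> (\<integral>x. G x *\<^sub>R X x \<partial>P \<theta>)"
      using int by (intro integral_inner_right)
    finally show ?thesis
      using weight_pos[OF \<theta>] by (simp add: tilted_mean_def)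
  qed
  ultimately have K: "((\<lambda>\<theta>'. \<integral>x. exp ((\<eta> \<theta>' - \<eta> \<theta>) \<bullet> X x) *\<^sub>R G x \<partial>P \<theta>) has_derivative
      (\<lambda>v. (D \<theta> *v v) \<bullet> (weight \<theta> *\<^sub>R tilted_mean \<theta>))) (at \<theta>)"
    by (simp only:)
  have E: "((\<lambda>\<theta>'. exp (A \<theta> - A \<theta>')) has_derivative (\<lambda>v. - ((D \<theta> *v v) \<bullet> \<theta>))) (at \<theta>)"
    by (auto intro!: derivative_eq_intros log_partition_derivative[OF \<theta>])
  show "(weight has_derivative (\<lambda>v. weight \<theta> * ((D \<theta> *v v) \<bullet> (tilted_mean \<theta> - \<theta>)))) (at \<theta>)"
  proof (rule has_derivative_transform_within_open[OF _ open_U \<theta>])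
    show "((\<lambda>\<theta>'. exp (A \<theta> - A \<theta>') * (\<integral>x. exp ((\<eta> \<theta>' - \<eta> \<theta>) \<bullet> X x) *\<^sub>R G x \<partial>P \<theta>)) has_derivative
        (\<lambda>v. weight \<theta> * ((D \<theta> *v v) \<bullet> (tilted_mean \<theta> - \<theta>)))) (at \<theta>)"
      by (rule has_derivative_eq_rhs[OF has_derivative_mult[OF E K]])
        (simp add: fun_eq_iff weight_def inner_diff_right algebra_simps)
    show "exp (A \<theta> - A \<theta>') * (\<integral>x. exp ((\<eta> \<theta>' - \<eta> \<theta>) \<bullet> X x) *\<^sub>R G x \<partial>P \<theta>) = weight \<theta>'" if "\<theta>' \<in> U" for \<theta>'
      using integral_change_parameter[of G \<theta>' \<theta>] that \<theta> by (simp add: weight_def)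
  qed
qed

lemma neg_ln_weight_gradient:
  assumes \<theta>: "\<theta> \<in> U"
  shows "GDERIV (\<lambda>\<theta>. - ln (weight \<theta>)) \<theta> :> - (D \<theta> *v (tilted_mean \<theta> - \<theta>))"
  unfolding gderiv_def inner_minus_right inner_jacobian[OF \<theta>]
  using weight_pos[OF \<theta>]
  by (auto intro!: derivative_eq_intros weight_derivative[OF \<theta>])

text \<open>Here \<open>q\<close> is the EM density. \<open>G x\<close> cancels inside the
  logarithm, leaving the density ratio times \<open>weight \<theta>'\<close>; the logarithm is then
  affine in \<open>X x\<close>, so only the \<open>G\<close>-weighted integrals of 1 and of
  \<open>X\<close> remain.\<close>

lemma
  fixes \<theta> \<theta>' :: "real ^ 'p"
  defines "q \<equiv> \<lambda>x. G x * p x \<theta>' / weight \<theta>'"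
  assumes \<theta>: "\<theta> \<in> U" "\<theta>' \<in> U"
  shows integrable_surrogate: "integrable M (\<lambda>x. q x * ln (G x * p x \<theta> / q x))"
    and integral_surrogate: "(\<integral>x. q x * ln (G x * p x \<theta> / q x) \<partial>M) =
        (\<eta> \<theta> - \<eta> \<theta>') \<bullet> tilted_mean \<theta>' - (A \<theta> - A \<theta>') + ln (weight \<theta>')"
proof -
  note [measurable] = p_measurable[OF \<theta>(2)]
  note pos = weight_pos[OF \<theta>(2)]
  have nn: "AE x in M. 0 \<le> p x \<theta>'"
    using p_pos \<theta> by (auto intro!: AE_I2 less_imp_le)
  \<comment> \<open>\<open>k\<close> collects the part of the logarithm free of \<open>x\<close>;
    \<open>r\<close> is the integrand divided by \<open>p x \<theta>'\<close>, hence a function to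
    integrate against \<open>P \<theta>'\<close>.\<close>
  define k where "k = ln (weight \<theta>') - (A \<theta> - A \<theta>')"
  define r where "r x = (1 / weight \<theta>') * ((\<eta> \<theta> - \<eta> \<theta>') \<bullet> (G x *\<^sub>R X x) + k * G x)" for x
  have [measurable]: "r \<in> borel_measurable M" unfolding r_def[abs_def] by measurable
  have eq: "q x * ln (G x * p x \<theta> / q x) = p x \<theta>' *\<^sub>R r x" if "x \<in> space M" for x
  proof -
    have "G x * p x \<theta> / q x = exp ((\<eta> \<theta> - \<eta> \<theta>') \<bullet> X x - (A \<theta> - A \<theta>')) * weight \<theta>'"
      using p_ratio[OF that \<theta>] p_pos[OF that \<theta>(2)] G_pos[OF that] pos by (simp add: q_def field_simps)
    then show ?thesis
      using pos by (simp add: q_def r_def k_def ln_mult field_simps)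
  qed
  have r: "integrable (P \<theta>') r"
    unfolding r_def[abs_def] using integrable_weighted[OF \<theta>(2)] G_integrable[OF \<theta>(2)]
    by (intro integrable_mult_right Bochner_Integration.integrable_add integrable_inner_right)
  show "integrable M (\<lambda>x. q x * ln (G x * p x \<theta> / q x))"
    using r nn by (subst Bochner_Integration.integrable_cong[OF refl eq]) (auto simp: integrable_density)
  have "(\<integral>x. q x * ln (G x * p x \<theta> / q x) \<partial>M) = (\<integral>x. p x \<theta>' *\<^sub>R r x \<partial>M)"
    by (rule Bochner_Integration.integral_cong[OF refl eq])
  also have "\<dots> = (\<integral>x. r x \<partial>P \<theta>')"
    using nn by (intro integral_density[symmetric]) auto
  also have "\<dots> = (1 / weight \<theta>') * ((\<eta> \<theta> - \<eta> \<theta>') \<bullet> (\<integral>x. G x *\<^sub>R X x \<partial>P \<theta>') + k * weight \<theta>')"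
    unfolding r_def using integrable_weighted[OF \<theta>(2)] G_integrable[OF \<theta>(2)]
    by (simp add: weight_def del: inner_scaleR_right)
  also have "\<dots> = (\<eta> \<theta> - \<eta> \<theta>') \<bullet> tilted_mean \<theta>' - (A \<theta> - A \<theta>') + ln (weight \<theta>')"
    using pos by (simp add: tilted_mean_def k_def field_simps)
  finally show "(\<integral>x. q x * ln (G x * p x \<theta> / q x) \<partial>M) =
      (\<eta> \<theta> - \<eta> \<theta>') \<bullet> tilted_mean \<theta>' - (A \<theta> - A \<theta>') + ln (weight \<theta>')" .
qed

text \<open>Only \<open>\<eta> \<theta> \<bullet> tilted_mean \<theta>' - A \<theta>\<close> varies
  with \<open>\<theta>\<close>. The gradient of its first term is
  \<open>D \<theta> *v tilted_mean \<theta>'\<close> by symmetry of \<open>D \<theta>\<close>, that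
  of \<open>A\<close> is \<open>D \<theta> *v \<theta>\<close>.\<close>

lemma surrogate_gradient:
  assumes \<theta>: "\<theta> \<in> U" "\<theta>' \<in> U"
    and u: "\<And>\<theta>. \<theta> \<in> U \<Longrightarrow>
      u \<theta> = - (\<integral>x. G x * p x \<theta>' / weight \<theta>' * ln (G x * p x \<theta> / (G x * p x \<theta>' / weight \<theta>')) \<partial>M)"
  shows "GDERIV u \<theta> :> - (D \<theta> *v (tilted_mean \<theta>' - \<theta>))"
  unfolding gderiv_def
proof (rule has_derivative_transform_within_open[OF _ open_U \<theta>(1)])
  show "((\<lambda>\<theta>. - ((\<eta> \<theta> - \<eta> \<theta>') \<bullet> tilted_mean \<theta>' - (A \<theta> - A \<theta>') + ln (weight \<theta>'))) has_derivative
      (\<lambda>h. h \<bullet> - (D \<theta> *v (tilted_mean \<theta>' - \<theta>)))) (at \<theta>)"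
    unfolding inner_minus_right inner_jacobian[OF \<theta>(1)]
    by (auto intro!: derivative_eq_intros log_partition_derivative[OF \<theta>(1)] \<eta>_derivative[OF \<theta>(1)]
        simp: fun_eq_iff inner_diff_right)
qed (simp only: u integral_surrogate[OF _ \<theta>(2)])

text \<open>Both sides say \<open>\<theta> = tilted_mean \<theta>'\<close>: on the left the
  invertible \<open>D \<theta>\<close> at the new point drops out, on the right
  \<open>D \<theta>'\<close> at the old point cancels against its inverse.\<close>

lemma stationary_iff_natural_gradient:
  assumes \<theta>: "\<theta> \<in> U" "\<theta>' \<in> U"
    and u: "\<And>\<theta>. \<theta> \<in> U \<Longrightarrow>
      u \<theta> = - (\<integral>x. G x * p x \<theta>' / weight \<theta>' * ln (G x * p x \<theta> / (G x * p x \<theta>' / weight \<theta>')) \<partial>M)"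
    and f: "\<And>\<theta>. \<theta> \<in> U \<Longrightarrow> f \<theta> = - ln (weight \<theta>)"
  shows "GDERIV u \<theta> :> 0 \<longleftrightarrow> \<theta> = \<theta>' - matrix_inv (D \<theta>') *v gradient f \<theta>'"
proof -
  have "GDERIV f \<theta>' :> - (D \<theta>' *v (tilted_mean \<theta>' - \<theta>'))"
    using has_derivative_transform_within_open[OF neg_ln_weight_gradient[OF \<theta>(2), unfolded gderiv_def] open_U \<theta>(2)] f
    by (auto simp: gderiv_def)
  then have grad_f: "gradient f \<theta>' = - (D \<theta>' *v (tilted_mean \<theta>' - \<theta>'))"
    by (rule gradient_eqI)
  have "matrix_inv (D \<theta>') *v (D \<theta>' *v v) = v" for v
    using D_invertible[OF \<theta>(2)] by (simp add: matrix_vector_mul_assoc invertible_matrix_inv)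
  then have step: "\<theta>' - matrix_inv (D \<theta>') *v gradient f \<theta>' = tilted_mean \<theta>'"
    by (simp add: grad_f linear_neg[OF matrix_vector_mul_linear])
  have inj: "D \<theta> *v v = 0 \<longleftrightarrow> v = 0" for v
    using D_invertible[OF \<theta>(1)]
    by (metis invertible_matrix_inv matrix_vector_mul_assoc matrix_vector_mul_lid matrix_vector_mult_0_right)
  note grad_u = surrogate_gradient[OF \<theta> u]
  have "GDERIV u \<theta> :> 0 \<longleftrightarrow> D \<theta> *v (tilted_mean \<theta>' - \<theta>) = 0"
    using grad_u gradient_eqI[OF grad_u] gradient_eqI[of u \<theta> 0] by auto
  then show ?thesis
    unfolding step inj by auto
qed

end

section \<open>Absorbing \<open>\<Omega>\<close> and returning to the original
  parametrisation\<close>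

theorem theorem3p3:
  fixes \<Theta> :: "(real ^ 'p) set"
    and f :: "real ^ 'p \<Rightarrow> real"
    and \<mu> :: "'x::euclidean_space measure"
    and \<Xi> :: "'x set"
    and p :: "'x \<Rightarrow> real ^ 'p \<Rightarrow> real"
    and G :: "'x \<Rightarrow> real"
    and A :: "real ^ 'p \<Rightarrow> real"
    and \<beta> :: "'x \<Rightarrow> real"
    and \<eta> :: "real ^ 'p \<Rightarrow> real ^ 'p"
    and \<gamma> :: "'x \<Rightarrow> real ^ 'p"
    and \<Omega> :: "real ^ 'p ^ 'p"
  assumes "closed \<Theta>" and "convex \<Theta>"
    and "density_family \<mu> \<Xi> \<Theta> p"
    and "\<forall>x\<in>\<Xi>. G x > 0"
    and "\<forall>\<theta>\<in>interior \<Theta>. integrable (model_distr \<mu> \<Xi> p \<theta>) G \<and>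
           f \<theta> = - ln (\<integral>x. G x \<partial>model_distr \<mu> \<Xi> p \<theta>)"
    and "\<forall>x\<in>\<Xi>. \<forall>\<theta>\<in>interior \<Theta>. p x differentiable (at \<theta>)"
    and "exponential_family \<Xi> \<Theta> p \<beta> \<gamma> \<eta> A"
    and "\<forall>\<theta>\<in>interior \<Theta>. \<eta> differentiable (at \<theta>) \<and> invertible (jacobian \<eta> (at \<theta>))"
    and "invertible \<Omega>"
    and "\<forall>\<theta>\<in>interior \<Theta>. integrable (model_distr \<mu> \<Xi> p \<theta>) (\<lambda>x. \<Omega> *v \<gamma> x) \<and>
           (\<integral>x. \<Omega> *v \<gamma> x \<partial>model_distr \<mu> \<Xi> p \<theta>) = \<theta>"
  shows "(\<forall>\<theta>\<in>interior \<Theta>.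
            integrable (model_distr \<mu> \<Xi> p \<theta>) (\<lambda>x. outer_product (score p \<theta> x) (score p \<theta> x)) \<and>
            integrable (model_distr \<mu> \<Xi> p \<theta>) (\<lambda>x. outer_product (\<Omega> *v \<gamma> x - \<theta>) (\<Omega> *v \<gamma> x - \<theta>)) \<and>
            invertible (covariance_matrix (model_distr \<mu> \<Xi> p \<theta>) (\<lambda>x. \<Omega> *v \<gamma> x)) \<and>
            fisher_information \<mu> \<Xi> p \<theta> =
              matrix_inv (covariance_matrix (model_distr \<mu> \<Xi> p \<theta>) (\<lambda>x. \<Omega> *v \<gamma> x)) \<and>
            matrix_inv (covariance_matrix (model_distr \<mu> \<Xi> p \<theta>) (\<lambda>x. \<Omega> *v \<gamma> x)) =
              transpose (jacobian \<eta> (at \<theta>)) ** matrix_inv \<Omega>)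
         \<and>
         ((\<forall>\<theta>\<in>interior \<Theta>. f differentiable (at \<theta>)) \<longrightarrow>
            (\<forall>\<theta>\<^sub>p\<^sub>r\<^sub>e\<^sub>v\<in>interior \<Theta>. \<forall>\<theta>\<^sub>n\<^sub>e\<^sub>x\<^sub>t\<in>interior \<Theta>.
               set_integrable \<mu> \<Xi> (em_integrand \<mu> \<Xi> p G \<theta>\<^sub>n\<^sub>e\<^sub>x\<^sub>t \<theta>\<^sub>p\<^sub>r\<^sub>e\<^sub>v) \<and>
               (GDERIV (\<lambda>\<theta>. em_surrogate \<mu> \<Xi> p G \<theta> \<theta>\<^sub>p\<^sub>r\<^sub>e\<^sub>v) \<theta>\<^sub>n\<^sub>e\<^sub>x\<^sub>t :> 0 \<longleftrightarrow>
                \<theta>\<^sub>n\<^sub>e\<^sub>x\<^sub>t = \<theta>\<^sub>p\<^sub>r\<^sub>e\<^sub>v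
                  - matrix_inv (fisher_information \<mu> \<Xi> p \<theta>\<^sub>p\<^sub>r\<^sub>e\<^sub>v) *v gradient f \<theta>\<^sub>p\<^sub>r\<^sub>e\<^sub>v)))"
proof (cases "interior \<Theta> = {}")
  case True
  then show ?thesis by simp
next
  case False
  \<comment> \<open>A witness parameter is wanted because measurability of
    \<open>\<Omega> *v \<gamma> x\<close> and of \<open>G\<close> is read off from their
    integrability under one member of the family.\<close>
  then obtain \<theta>\<^sub>0 where \<theta>\<^sub>0: "\<theta>\<^sub>0 \<in> interior \<Theta>" by blast
  define M where "M = restrict_space \<mu> \<Xi>"
  have \<Xi>: "\<Xi> \<in> sets \<mu>" and p_pos: "\<And>x \<theta>. x \<in> \<Xi> \<Longrightarrow> \<theta> \<in> interior \<Theta> \<Longrightarrow> 0 < p x \<theta>"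
    and p_measurable: "\<And>\<theta>. \<theta> \<in> interior \<Theta> \<Longrightarrow> (\<lambda>x. p x \<theta>) \<in> borel_measurable M"
    and prob: "\<And>\<theta>. \<theta> \<in> interior \<Theta> \<Longrightarrow> prob_space (model_distr \<mu> \<Xi> p \<theta>)"
    using assms(3) by (auto simp: density_family_def M_def)
  have space_M: "space M = \<Xi>"
    using sets.sets_into_space[OF \<Xi>] by (auto simp: M_def space_restrict_space)
  have P: "model_distr \<mu> \<Xi> p = (\<lambda>\<theta>. density M (\<lambda>x. ennreal (p x \<theta>)))"
    by (simp add: fun_eq_iff model_distr_def M_def)
  \<comment> \<open>The inverse transpose is the change of natural parameter that keeps the exponent
    \<open>\<gamma> x \<bullet> \<eta> \<theta>\<close> fixed when \<open>\<gamma> x\<close> becomes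
    \<open>\<Omega> *v \<gamma> x\<close>.\<close>
  define T where "T = transpose (matrix_inv \<Omega>)"
  have T: "transpose T = matrix_inv \<Omega>" "invertible T" "(T *v y) \<bullet> (\<Omega> *v v) = y \<bullet> v" for y v
  proof -
    note \<Omega> = invertible_matrix_inv[OF assms(9)]
    show "transpose T = matrix_inv \<Omega>" by (simp add: T_def)
    have "invertible (matrix_inv \<Omega>)" using \<Omega> by (auto simp: invertible_def)
    then show "invertible T" unfolding T_def by (rule invertible_transpose)
    have "(T *v y) \<bullet> (\<Omega> *v v) = y \<bullet> (matrix_inv \<Omega> *v (\<Omega> *v v))"
      using inner_transpose_matrix_vector[of "\<Omega> *v v" "matrix_inv \<Omega>" y]
      by (simp only: T_def inner_commute)
    then show "(T *v y) \<bullet> (\<Omega> *v v) = y \<bullet> v"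
      using \<Omega> by (simp add: matrix_vector_mul_assoc)
  qed
  interpret weighted_unbiased_exponential_family M "interior \<Theta>" p "\<lambda>x. \<Omega> *v \<gamma> x"
    "\<lambda>\<theta>. T *v \<eta> \<theta>" "\<lambda>\<theta>. T ** jacobian \<eta> (at \<theta>)" A G
  proof (intro weighted_unbiased_exponential_family.intro unbiased_exponential_family.intro
      weighted_unbiased_exponential_family_axioms.intro)
    fix \<theta> assume \<theta>: "\<theta> \<in> interior \<Theta>"
    have "(\<eta> has_derivative (*v) (jacobian \<eta> (at \<theta>))) (at \<theta>)"
      using assms(8) \<theta> jacobian_works[of \<eta> "at \<theta>"] by auto
    from bounded_linear.has_derivative[OF matrix_vector_mul_bounded_linear[of T] this]
    show "((\<lambda>\<theta>. T *v \<eta> \<theta>) has_derivative (*v) (T ** jacobian \<eta> (at \<theta>))) (at \<theta>)"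
      by (simp add: matrix_vector_mul_assoc)
    show "invertible (T ** jacobian \<eta> (at \<theta>))"
      using assms(8) \<theta> T(2) by (simp add: invertible_mult)
    show "integrable (density M (\<lambda>x. ennreal (p x \<theta>))) G"
      using assms(5) \<theta> by (simp add: P)
    show "integrable (density M (\<lambda>x. ennreal (p x \<theta>))) (\<lambda>x. \<Omega> *v \<gamma> x)"
      and "(\<integral>x. \<Omega> *v \<gamma> x \<partial>density M (\<lambda>x. ennreal (p x \<theta>))) = \<theta>"
      using assms(10) \<theta> by (simp_all add: P)
    show "(\<lambda>x. p x \<theta>) \<in> borel_measurable M"
      using \<theta> by (rule p_measurable)
    show "prob_space (density M (\<lambda>x. ennreal (p x \<theta>)))"
      using prob[OF \<theta>] by (simp add: P)
  next
    fix x \<theta> \<theta>' assume *: "x \<in> space M" "\<theta> \<in> interior \<Theta>" "\<theta>' \<in> interior \<Theta>"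
    have "p x \<theta> = \<beta> x * exp (\<gamma> x \<bullet> \<eta> \<theta> - A \<theta>)" if "\<theta> \<in> interior \<Theta>" for \<theta>
      using assms(7) * that by (simp add: exponential_family_def space_M)
    then show "p x \<theta> = p x \<theta>' * exp ((T *v \<eta> \<theta> - T *v \<eta> \<theta>') \<bullet> (\<Omega> *v \<gamma> x) - (A \<theta> - A \<theta>'))"
      using * by (simp add: T inner_diff_left inner_commute[of "\<gamma> x"] mult.assoc flip: exp_add)
  next
    show "open (interior \<Theta>)" by (rule open_interior)
    show "(\<lambda>x. \<Omega> *v \<gamma> x) \<in> borel_measurable M"
      using assms(10) \<theta>\<^sub>0 borel_measurable_integrable[of "density M (\<lambda>x. ennreal (p x \<theta>\<^sub>0))" "\<lambda>x. \<Omega> *v \<gamma> x"]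
      by (simp add: P)
    show "G \<in> borel_measurable M"
      using assms(5) \<theta>\<^sub>0 borel_measurable_integrable[of "density M (\<lambda>x. ennreal (p x \<theta>\<^sub>0))" G]
      by (simp add: P)
  next
    show "0 < G x" if "x \<in> space M" for x
      using assms(4) that by (simp add: space_M)
    show "0 < p x \<theta>" if "x \<in> space M" "\<theta> \<in> interior \<Theta>" for x \<theta>
      using p_pos that by (simp add: space_M)
  qed
  let ?D = "\<lambda>\<theta>. T ** jacobian \<eta> (at \<theta>)"
  have fisher: "fisher_information \<mu> \<Xi> p \<theta> = ?D \<theta>" if "\<theta> \<in> interior \<Theta>" for \<theta>
    by (simp only: fisher_information_def P fisher_information_integral(2)[OF that])
  have cov_inv: "matrix_inv (covariance_matrix (P \<theta>) (\<lambda>x. \<Omega> *v \<gamma> x)) = ?D \<theta>" if "\<theta> \<in> interior \<Theta>" for \<theta>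
    by (rule matrix_inv_eqI[OF covariance_times_jacobian[OF that]])
  \<comment> \<open>Symmetry of \<open>?D \<theta>\<close> is what brings the inverse of
    \<open>\<Omega>\<close> to the right: the transpose of
    \<open>T ** jacobian \<eta> (at \<theta>)\<close> is the stated product.\<close>
  have D_eq: "?D \<theta> = transpose (jacobian \<eta> (at \<theta>)) ** matrix_inv \<Omega>" if "\<theta> \<in> interior \<Theta>" for \<theta>
    using transpose_jacobian[OF that] by (simp only: matrix_transpose_mul T(1))
  have surrogate: "em_integrand \<mu> \<Xi> p G \<theta> \<theta>' =
      (\<lambda>x. G x * p x \<theta>' / weight \<theta>' * ln (G x * p x \<theta> / (G x * p x \<theta>' / weight \<theta>')))" for \<theta> \<theta>'
    by (simp add: fun_eq_iff em_integrand_def em_density_def weight_def P)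
  have u: "em_surrogate \<mu> \<Xi> p G \<theta> \<theta>' =
      - (\<integral>x. G x * p x \<theta>' / weight \<theta>' * ln (G x * p x \<theta> / (G x * p x \<theta>' / weight \<theta>')) \<partial>M)" for \<theta> \<theta>'
    using \<Xi> by (simp only: em_surrogate_def set_lebesgue_integral_def surrogate M_def
        integral_restrict_space sets.Int sets.top)
  show ?thesis
  proof (intro conjI ballI impI)
    fix \<theta> assume \<theta>: "\<theta> \<in> interior \<Theta>"
    show "integrable (model_distr \<mu> \<Xi> p \<theta>) (\<lambda>x. outer_product (score p \<theta> x) (score p \<theta> x))"
      unfolding P by (rule fisher_information_integral(1)[OF \<theta>])
    show "integrable (model_distr \<mu> \<Xi> p \<theta>) (\<lambda>x. outer_product (\<Omega> *v \<gamma> x - \<theta>) (\<Omega> *v \<gamma> x - \<theta>))"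
      unfolding P by (rule integrable_outer_product[OF \<theta>])
    show "invertible (covariance_matrix (model_distr \<mu> \<Xi> p \<theta>) (\<lambda>x. \<Omega> *v \<gamma> x))"
      using covariance_times_jacobian[OF \<theta>] unfolding P invertible_right_inverse by blast
    show "fisher_information \<mu> \<Xi> p \<theta> =
        matrix_inv (covariance_matrix (model_distr \<mu> \<Xi> p \<theta>) (\<lambda>x. \<Omega> *v \<gamma> x))"
      using fisher[OF \<theta>] cov_inv[OF \<theta>] by (simp add: P)
    show "matrix_inv (covariance_matrix (model_distr \<mu> \<Xi> p \<theta>) (\<lambda>x. \<Omega> *v \<gamma> x)) =
        transpose (jacobian \<eta> (at \<theta>)) ** matrix_inv \<Omega>"
      using cov_inv[OF \<theta>] D_eq[OF \<theta>] by (simp add: P)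
  next
    fix \<theta>' \<theta> assume \<theta>: "\<theta>' \<in> interior \<Theta>" "\<theta> \<in> interior \<Theta>"
    show "set_integrable \<mu> \<Xi> (em_integrand \<mu> \<Xi> p G \<theta> \<theta>')"
      using integrable_surrogate[OF \<theta>(2,1)] \<Xi>
      by (simp only: set_integrable_def surrogate M_def integrable_restrict_space sets.Int sets.top)
    show "GDERIV (\<lambda>\<theta>. em_surrogate \<mu> \<Xi> p G \<theta> \<theta>') \<theta> :> 0 \<longleftrightarrow>
        \<theta> = \<theta>' - matrix_inv (fisher_information \<mu> \<Xi> p \<theta>') *v gradient f \<theta>'"
      unfolding fisher[OF \<theta>(1)]
      by (rule stationary_iff_natural_gradient[OF \<theta>(2,1) u]) (use assms(5) in \<open>simp add: weight_def P\<close>)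
  qed
qed

end
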